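(* Let $d,n,N,C,s\ge 1$ be integers, $\epsilon>0$, $r_{\max}>r_{\min}>0$, and let $(\mathbf{X}^{(1)},\mathbf{Y}^{(1)}),\dots,(\mathbf{X}^{(N)},\mathbf{Y}^{(N)})\in\mathbb{R}^{d\times n}\times[C]^{d\times n}$ be input-output pairs of sequences such that $\mathbf{X}^{(1)},\dots,\mathbf{X}^{(N)}$ are tokenwise $(r_{\min},r_{\max},\epsilon)$-separated, have no duplicate token in each sequence (that is, $\mathbf{X}^{(i)}_{:,k}\ne\mathbf{X}^{(i)}_{:,l}$ for all $i\in[N]$ and $k\ne l$ in $[n]$), and are consistently labeled, that is, $\mathbf{Y}^{(i)}_{:,k}=\mathbf{Y}^{(j)}_{:,l}$ holds for any $i,j\in[N]$ and $k,l\in[n]$ such that $\mathcal{V}^{(i)}=\mathcal{V}^{(j)}$ and $\mathbf{X}^{(i)}_{:,k}=\mathbf{X}^{(j)}_{:,l}$. Then there exist $4(s+d)+d(2nN+d)$ weight parameters, defining a one-layer Transformer $\mathcal{F}=\mathcal{F}^{(FF)}\circ\mathcal{F}^{(SA)}_S$ with single-head softmax self-attention of head size $s$, such that for any $i\in[N]$ $$\mathcal{F}\left(\mathbf{X}^{(i)}\right)=\mathcal{F}^{(FF)}\left(\mathcal{F}^{(SA)}_S\left(\mathbf{X}^{(i)}\right)\right)=\mathbf{Y}^{(i)}.$$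
   Context: $[m]=\{1,\dots,m\}$; $\|\cdot\|$ is the $\ell^2$ norm; $\mathbf{A}_{:,k}$ is the $k$-th column of $\mathbf{A}$. $\sigma_S$ is the softmax function, applied column by column to matrices; $\sigma_R$ is the elementwise ReLU. Vocabulary sets: $\mathcal{V}^{(i)}=\{\mathbf{X}^{(i)}_{:,k}:k\in[n]\}\subset\mathbb{R}^d$. Tokenwise $(r_{\min},r_{\max},\epsilon)$-separated: $r_{\min}<\|\mathbf{X}^{(i)}_{:,k}\|<r_{\max}$ for all $i\in[N]$, $k\in[n]$, and $\|\mathbf{X}^{(i)}_{:,k}-\mathbf{X}^{(j)}_{:,l}\|>\epsilon$ for all $i,j\in[N]$, $k,l\in[n]$ with $\mathbf{X}^{(i)}_{:,k}\ne\mathbf{X}^{(j)}_{:,l}$. Single-head self-attention layer: $\mathcal{F}^{(SA)}_S(\mathbf{Z})=\mathbf{Z}+\mathbf{W}^{(O)}(\mathbf{W}^{(V)}\mathbf{Z})\,\sigma_S[(\mathbf{W}^{(K)}\mathbf{Z})^\top(\mathbf{W}^{(Q)}\mathbf{Z})]$ for $\mathbf{Z}\in\mathbb{R}^{d\times n}$, with $\mathbf{W}^{(V)},\mathbf{W}^{(K)},\mathbf{W}^{(Q)}\in\mathbb{R}^{s\times d}$ and $\mathbf{W}^{(O)}\in\mathbb{R}^{d\times s}$. Feed-forward layer: $\mathcal{F}^{(FF)}(\mathbf{H})_{:,k}=\mathbf{H}_{:,k}+\mathbf{W}^{(2)}\sigma_R[\mathbf{W}^{(1)}\mathbf{H}_{:,k}+\mathbf{b}^{(1)}]+\mathbf{b}^{(2)}$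 for $\mathbf{H}\in\mathbb{R}^{d\times n}$ and $k\in[n]$, with $\mathbf{W}^{(1)}\in\mathbb{R}^{q\times d}$, $\mathbf{W}^{(2)}\in\mathbb{R}^{d\times q}$, $\mathbf{b}^{(1)}\in\mathbb{R}^q$, $\mathbf{b}^{(2)}\in\mathbb{R}^d$, for some hidden dimension $q\ge 1$. Parameter count: weight parameters are the free real scalars specifying the weights. A rank-1 matrix in $\mathbb{R}^{s\times d}$ or $\mathbb{R}^{d\times s}$, written as an outer product of two vectors, counts as $s+d$ parameters. In the feed-forward layer, entries of the weights and biases that are fixed to $0$ are not counted, and a scalar shared by several entries is counted once. The number $4(s+d)+d(2nN+d)$ is an upper bound on the count (unused parameters are allowed). *)

theory Defs
  imports Complex_Main "HOL-Analysis.L2_Norm" "Jordan_Normal_Form.Matrix"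
begin

definition l2_norm :: "real vec \<Rightarrow> real" where
  "l2_norm v = L2_set (\<lambda>i. v $ i) {..<dim_vec v}"

definition vocabulary :: "real mat \<Rightarrow> real vec set" where
  "vocabulary X = {col X k | k. k < dim_col X}"

text \<open>Sequence and token indices are 0-based: sequences \<open>X i\<close> with \<open>i < N\<close>, tokens
  \<open>col (X i) k\<close> with \<open>k < n\<close>.\<close>

definition tokenwise_separated ::
  "nat \<Rightarrow> nat \<Rightarrow> real \<Rightarrow> real \<Rightarrow> real \<Rightarrow> (nat \<Rightarrow> real mat) \<Rightarrow> bool" where
  "tokenwise_separated N n rmin rmax \<epsilon> X \<longleftrightarrow>
     (\<forall>i<N. \<forall>k<n. rmin < l2_norm (col (X i) k) \<and> l2_norm (col (X i) k) < rmax) \<and>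
     (\<forall>i<N. \<forall>j<N. \<forall>k<n. \<forall>l<n. col (X i) k \<noteq> col (X j) l \<longrightarrow>
        l2_norm (col (X i) k - col (X j) l) > \<epsilon>)"

definition no_duplicate_tokens :: "nat \<Rightarrow> nat \<Rightarrow> (nat \<Rightarrow> real mat) \<Rightarrow> bool" where
  "no_duplicate_tokens N n X \<longleftrightarrow>
     (\<forall>i<N. \<forall>k<n. \<forall>l<n. k \<noteq> l \<longrightarrow> col (X i) k \<noteq> col (X i) l)"

definition consistently_labeled ::
  "nat \<Rightarrow> nat \<Rightarrow> (nat \<Rightarrow> real mat) \<Rightarrow> (nat \<Rightarrow> nat mat) \<Rightarrow> bool" where
  "consistently_labeled N n X Y \<longleftrightarrow>
     (\<forall>i<N. \<forall>j<N. \<forall>k<n. \<forall>l<n.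
        vocabulary (X i) = vocabulary (X j) \<and> col (X i) k = col (X j) l \<longrightarrow>
        col (Y i) k = col (Y j) l)"

definition softmax :: "real vec \<Rightarrow> real vec" where
  "softmax v = vec (dim_vec v) (\<lambda>i. exp (v $ i) / (\<Sum>j<dim_vec v. exp (v $ j)))"

definition softmax_mat :: "real mat \<Rightarrow> real mat" where
  "softmax_mat A = mat_of_cols (dim_row A) (map softmax (cols A))"

definition relu_vec :: "real vec \<Rightarrow> real vec" where
  "relu_vec = map_vec (\<lambda>x. max 0 x)"

record transformer_weights =
  WO :: "real mat"
  WV :: "real mat"
  WK :: "real mat"
  WQ :: "real mat"
  W1 :: "real mat"
  b1 :: "real vec"
  W2 :: "real mat"
  b2 :: "real vec"

definition self_attention :: "transformer_weights \<Rightarrow> real mat \<Rightarrow> real mat" where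
  "self_attention w Z =
     Z + WO w * (WV w * Z) * softmax_mat (transpose_mat (WK w * Z) * (WQ w * Z))"

definition feed_forward_token :: "transformer_weights \<Rightarrow> real vec \<Rightarrow> real vec" where
  "feed_forward_token w h = h + W2 w *\<^sub>v relu_vec (W1 w *\<^sub>v h + b1 w) + b2 w"

definition feed_forward :: "transformer_weights \<Rightarrow> real mat \<Rightarrow> real mat" where
  "feed_forward w H = mat_of_cols (dim_row H) (map (feed_forward_token w) (cols H))"

definition transformer :: "transformer_weights \<Rightarrow> real mat \<Rightarrow> real mat" where
  "transformer w = feed_forward w \<circ> self_attention w"

text \<open>An architecture says how the weights are specified by free real scalars.

  Each attention matrix is either unrestricted (one scalar per entry) or an outer product
  of two free vectors. In the feed-forward layer every entry carries a label:
  \<open>None\<close> means that the entry is fixed to 0, and \<open>Some p\<close> that it is the value of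
  the free scalar number \<open>p\<close>, so that entries with equal labels share one scalar.

  The architecture does not contain the values of the scalars: a weight that merely happens to be
  0, or to coincide with another weight, is still counted.\<close>

datatype matrix_form = Unrestricted | Outer_Product

fun matrix_form_count :: "matrix_form \<Rightarrow> nat \<Rightarrow> nat \<Rightarrow> nat" where
  "matrix_form_count Unrestricted nr nc = nr * nc"
| "matrix_form_count Outer_Product nr nc = nr + nc"

definition outer_product :: "real vec \<Rightarrow> real vec \<Rightarrow> real mat" where
  "outer_product u v = mat (dim_vec u) (dim_vec v) (\<lambda>(i, j). u $ i * v $ j)"

fun has_form :: "matrix_form \<Rightarrow> real mat \<Rightarrow> bool" where
  "has_form Unrestricted A \<longleftrightarrow> True"
| "has_form Outer_Product A \<longleftrightarrow> (\<exists>u v. A = outer_product u v)"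

record architecture =
  form_O :: matrix_form
  form_V :: matrix_form
  form_K :: matrix_form
  form_Q :: matrix_form
  labels_W1 :: "nat option mat"
  labels_b1 :: "nat option vec"
  labels_W2 :: "nat option mat"
  labels_b2 :: "nat option vec"

definition feed_forward_shape :: "nat \<Rightarrow> architecture \<Rightarrow> bool" where
  "feed_forward_shape d A \<longleftrightarrow>
     (\<exists>q\<ge>1. labels_W1 A \<in> carrier_mat q d \<and> labels_b1 A \<in> carrier_vec q \<and>
            labels_W2 A \<in> carrier_mat d q \<and> labels_b2 A \<in> carrier_vec d)"

definition feed_forward_scalars :: "architecture \<Rightarrow> nat set" where
  "feed_forward_scalars A =
     {p. Some p \<in> elements_mat (labels_W1 A) \<union> vec_set (labels_b1 A) \<union>
                  elements_mat (labels_W2 A) \<union> vec_set (labels_b2 A)}"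

definition parameter_count :: "nat \<Rightarrow> nat \<Rightarrow> architecture \<Rightarrow> nat" where
  "parameter_count d s A =
     matrix_form_count (form_O A) d s + matrix_form_count (form_V A) s d +
     matrix_form_count (form_K A) s d + matrix_form_count (form_Q A) s d +
     card (feed_forward_scalars A)"

fun label_value :: "(nat \<Rightarrow> real) \<Rightarrow> nat option \<Rightarrow> real" where
  "label_value \<theta> None = 0"
| "label_value \<theta> (Some p) = \<theta> p"

definition weights_of_architecture ::
  "nat \<Rightarrow> nat \<Rightarrow> architecture \<Rightarrow> transformer_weights \<Rightarrow> bool" where
  "weights_of_architecture d s A w \<longleftrightarrow>
     WO w \<in> carrier_mat d s \<and> has_form (form_O A) (WO w) \<and>
     WV w \<in> carrier_mat s d \<and> has_form (form_V A) (WV w) \<and>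
     WK w \<in> carrier_mat s d \<and> has_form (form_K A) (WK w) \<and>
     WQ w \<in> carrier_mat s d \<and> has_form (form_Q A) (WQ w) \<and>
     (\<exists>\<theta>. W1 w = map_mat (label_value \<theta>) (labels_W1 A) \<and>
          b1 w = map_vec (label_value \<theta>) (labels_b1 A) \<and>
          W2 w = map_mat (label_value \<theta>) (labels_W2 A) \<and>
          b2 w = map_vec (label_value \<theta>) (labels_b2 A))"

end

theory Submission
  imports Defs
begin

text \<open>Project all tokens onto a generic direction \<open>a\<close>, which keeps distinct tokens distinct and
  nonzero. With rank-one attention matrices, a token of projection \<open>\<alpha>\<close> in a sequence whose
  projected vocabulary is \<open>S\<close> receives the exponentially weighted mean of \<open>S\<close> with rate \<open>\<mu> * \<alpha>\<close>.
  For different vocabularies these means differ once \<open>\<mu>\<close> is large, by comparing leading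
  exponentials; hence a generic multiple of the attention output separates all pairs of a token
  and a vocabulary already in the projection onto \<open>a\<close>. It remains to interpolate a function of
  one real variable at \<open>n * N\<close> nodes with as many ReLU neurons. The interpolated values are
  the labels minus the attention output, so the skip connection needs no neurons of its own, and
  \<open>d + n * N + d * (n * N)\<close> scalars suffice in the feed-forward layer.\<close>

section \<open>Generic projections\<close>

text \<open>A vector \<open>(1, r, ..., r^(d-1))\<close> on the moment curve works: its product with
  a nonzero \<open>v\<close> is a nonzero polynomial in \<open>r\<close>, so each of the finitely
  many \<open>v\<close> excludes only finitely many \<open>r\<close>.\<close>

lemma exists_generic_vec:
  fixes V :: "real vec set"
  assumes fin: "finite V" and dim: "V \<subseteq> carrier_vec d" and nz: "0\<^sub>v d \<notin> V"
  shows "\<exists>a\<in>carrier_vec d. \<forall>v\<in>V. a \<bullet> v \<noteq> 0"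
proof (cases "d = 0")
  case True
  then have "v = 0\<^sub>v d" if "v \<in> V" for v
    using that dim by (metis carrier_vecD eq_vecI index_zero_vec(2) less_nat_zero_code subsetD)
  then have "V = {}"
    using nz by blast
  then show ?thesis
    by (intro bexI[of _ "0\<^sub>v d"]) auto
next
  case False
  then obtain d' where d: "d = Suc d'"
    by (cases d) auto
  have "finite {r. (\<Sum>i\<le>d'. v $ i * r ^ i) = 0}" if "v \<in> V" for v
  proof -
    have "v \<in> carrier_vec d" "v \<noteq> 0\<^sub>v d"
      using that dim nz by auto
    then have "\<exists>i\<le>d'. v $ i \<noteq> 0"
      unfolding d by (metis carrier_vecD eq_vecI index_zero_vec less_Suc_eq_le)
    then show ?thesis
      using polyfun_finite_roots by blast
  qed
  then have "finite (\<Union>v\<in>V. {r. (\<Sum>i\<le>d'. v $ i * r ^ i) = 0})"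
    using fin by blast
  then obtain r where r: "r \<notin> (\<Union>v\<in>V. {r. (\<Sum>i\<le>d'. v $ i * r ^ i) = 0})"
    using ex_new_if_finite infinite_UNIV_char_0 by blast
  have "vec d (\<lambda>i. r ^ i) \<bullet> v \<noteq> 0" if "v \<in> V" for v
  proof -
    have "vec d (\<lambda>i. r ^ i) \<bullet> v = (\<Sum>i\<le>d'. v $ i * r ^ i)"
      using that dim unfolding scalar_prod_def d
      by (intro sum.cong) (auto simp: atLeast0LessThan lessThan_Suc_atMost mult.commute)
    then show ?thesis
      using r that by auto
  qed
  then show ?thesis
    by (intro bexI[of _ "vec d (\<lambda>i. r ^ i)"]) auto
qed

text \<open>Two points with different second coordinates collide for exactly one
  \<open>\<delta>\<close>; distinct points with equal second coordinates never collide. So only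
  finitely many values are bad.\<close>

lemma exists_inj_on_linear_comb:
  fixes P :: "(real \<times> real) set"
  assumes "finite P"
  shows "\<exists>\<delta>. inj_on (\<lambda>(p, q). p + \<delta> * q) P"
proof -
  \<comment> \<open>For \<open>q = q'\<close> division by zero yields 0, which merely excludes one
    more value.\<close>
  let ?bad = "(\<lambda>((p, q), (p', q')). (p' - p) / (q - q')) ` (P \<times> P)"
  have "finite ?bad"
    using assms by blast
  then obtain \<delta> where \<delta>: "\<delta> \<notin> ?bad"
    using ex_new_if_finite infinite_UNIV_char_0 by blast
  have "(p, q) = (p', q')" if "(p, q) \<in> P" "(p', q') \<in> P" "p + \<delta> * q = p' + \<delta> * q'" for p q p' q'
  proof (cases "q = q'")
    case False
    then have "\<delta> = (p' - p) / (q - q')"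
      using that(3) by (simp add: field_simps)
    then have "\<delta> \<in> ?bad"
      using that(1,2) by force
    then show ?thesis
      using \<delta> by contradiction
  qed (use that in auto)
  then show ?thesis
    by (intro exI[of _ \<delta>] inj_onI) auto
qed

section \<open>Exponentially weighted means\<close>

text \<open>Dividing by the dominant exponential \<open>exp (\<mu> * e m)\<close> leaves
  \<open>c m\<close> plus terms that tend to 0.\<close>

lemma eventually_exp_sum_nonzero:
  fixes c e :: "'i \<Rightarrow> real"
  assumes fin: "finite I" and m: "m \<in> I" "c m \<noteq> 0"
    and dom: "\<And>i. i \<in> I \<Longrightarrow> i \<noteq> m \<Longrightarrow> e i < e m"
  shows "\<forall>\<^sub>F \<mu> in at_top. (\<Sum>i\<in>I. c i * exp (\<mu> * e i)) \<noteq> 0"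
proof -
  have "((\<lambda>\<mu>. c i * exp (\<mu> * (e i - e m))) \<longlongrightarrow> (if i = m then c m else 0)) at_top"
    if "i \<in> I" for i
  proof (cases "i = m")
    case False
    then have "filterlim (\<lambda>\<mu>. (e i - e m) * \<mu>) at_bot at_top"
      using dom that
      by (intro filterlim_tendsto_neg_mult_at_bot[OF tendsto_const _ filterlim_ident]) auto
    then have "((\<lambda>\<mu>. exp ((e i - e m) * \<mu>)) \<longlongrightarrow> 0) at_top"
      by (rule filterlim_compose[OF exp_at_bot])
    then show ?thesis
      using False tendsto_mult[OF tendsto_const[of "c i"]] by (fastforce simp: mult.commute)
  qed auto
  then have "((\<lambda>\<mu>. \<Sum>i\<in>I. c i * exp (\<mu> * (e i - e m))) \<longlongrightarrow> (\<Sum>i\<in>I. if i = m then c m else 0)) at_top"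
    by (intro tendsto_sum) auto
  then have "((\<lambda>\<mu>. \<Sum>i\<in>I. c i * exp (\<mu> * (e i - e m))) \<longlongrightarrow> c m) at_top"
    using fin m by simp
  then have "\<forall>\<^sub>F \<mu> in at_top. (\<Sum>i\<in>I. c i * exp (\<mu> * (e i - e m))) \<noteq> 0"
    using m tendsto_imp_eventually_ne by blast
  moreover have "(\<Sum>i\<in>I. c i * exp (\<mu> * e i)) = exp (\<mu> * e m) * (\<Sum>i\<in>I. c i * exp (\<mu> * (e i - e m)))" for \<mu>
    by (simp add: sum_distrib_left exp_diff right_diff_distrib)
  ultimately show ?thesis
    by simp
qed

text \<open>For finite nonempty \<open>S\<close>, the mean under softmax (Gibbs) weights at inverse
  temperature \<open>\<mu>\<close>, that is, the derivative of log-sum-exp. Summing over a set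
  instead of over positions makes it a function of the vocabulary alone.\<close>

definition exp_mean :: "real set \<Rightarrow> real \<Rightarrow> real" where
  "exp_mean S \<mu> = (\<Sum>x\<in>S. x * exp (\<mu> * x)) / (\<Sum>x\<in>S. exp (\<mu> * x))"

lemma sum_exp_pos: "finite S \<Longrightarrow> S \<noteq> {} \<Longrightarrow> (\<Sum>x\<in>S. exp (\<mu> * x)) > (0::real)"
  by (simp add: sum_pos)

lemma exp_mean_scale:
  assumes "\<beta> \<noteq> 0"
  shows "exp_mean ((*) \<beta> ` S) \<mu> = \<beta> * exp_mean S (\<mu> * \<beta>)"
proof -
  have "inj_on ((*) \<beta>) S"
    using assms by (auto intro: inj_onI)
  then show ?thesis
    by (simp add: exp_mean_def sum.reindex sum_distrib_left mult.assoc)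
qed

text \<open>After clearing denominators, the difference of the two means becomes
  \<open>\<Sum>(x - y) exp (\<mu> (x + y))\<close> over \<open>S \<times> T\<close>. The elements above \<open>\<gamma> = Max ((S - T) \<union> (T - S))\<close> are
  common to both sets, so their pairs cancel by antisymmetry, and among the remaining pairs
  \<open>(\<gamma>, Max T)\<close> alone has the largest exponent.\<close>
lemma eventually_exp_mean_neq_aux:
  assumes fin: "finite S" "finite T" and ne: "S \<noteq> {}" "T \<noteq> {}"
    and \<gamma>: "\<gamma> \<in> S" "\<gamma> \<notin> T" and above: "\<And>x. x > \<gamma> \<Longrightarrow> x \<in> S \<longleftrightarrow> x \<in> T"
  shows "\<forall>\<^sub>F \<mu> in at_top. exp_mean S \<mu> \<noteq> exp_mean T \<mu>"
proof -
  define U where "U = {x\<in>S. x > \<gamma>}"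
  define I where "I = S \<times> T - U \<times> U"
  let ?c = "\<lambda>(x, y). x - y :: real" and ?e = "\<lambda>(x, y). x + y :: real"
  have UT: "U = {x\<in>T. x > \<gamma>}"
    using above by (auto simp: U_def)
  then have sub: "U \<times> U \<subseteq> S \<times> T"
    by (auto simp: U_def)
  have nonzero: "\<forall>\<^sub>F \<mu> in at_top. (\<Sum>p\<in>I. ?c p * exp (\<mu> * ?e p)) \<noteq> 0"
  proof (rule eventually_exp_sum_nonzero[where m = "(\<gamma>, Max T)"])
    show "finite I"
      using fin by (simp add: I_def)
    show "(\<gamma>, Max T) \<in> I"
      using \<gamma> fin ne by (simp add: I_def U_def)
    show "?c (\<gamma>, Max T) \<noteq> 0"
      using \<gamma> fin ne Max_in by force
    show "?e p < ?e (\<gamma>, Max T)" if "p \<in> I" "p \<noteq> (\<gamma>, Max T)" for p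
    proof -
      obtain x y where p: "p = (x, y)"
        by (cases p)
      have xy: "x \<in> S" "y \<in> T" and not_U: "x \<notin> U \<or> y \<notin> U"
        using that p by (auto simp: I_def)
      have yM: "y \<le> Max T"
        using xy fin by simp
      show ?thesis
      \<comment> \<open>If \<open>x\<close> is not above \<open>\<gamma>\<close>, the bounds
        \<open>x \<le> \<gamma>\<close> and \<open>y \<le> Max T\<close> suffice, one of them being
        strict. Otherwise \<open>x\<close> also lies in \<open>T\<close>, and the bounds trade
        places: \<open>x \<le> Max T\<close>, while \<open>y < \<gamma>\<close> because
        \<open>\<gamma>\<close> is missing from \<open>T\<close>.\<close>
      proof (cases "x \<in> U")
        case False
        then have "x \<le> \<gamma>"
          using xy by (simp add: U_def)
        then show ?thesis
          using yM that p by force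
      next
        case True
        then have "x \<le> Max T" "y \<le> \<gamma>" "y \<noteq> \<gamma>"
          using not_U xy fin \<gamma> by (auto simp: UT)
        then show ?thesis
          using p by simp
      qed
    qed
  qed
  have cancel: "(\<Sum>p\<in>U \<times> U. ?c p * exp (\<mu> * ?e p)) = 0" for \<mu>
  proof -
    have "(\<Sum>p\<in>U \<times> U. ?c p * exp (\<mu> * ?e p)) = (\<Sum>p\<in>U \<times> U. - (?c p * exp (\<mu> * ?e p)))"
      by (rule sum.reindex_bij_witness[where i = prod.swap and j = prod.swap])
        (auto simp: algebra_simps)
    then show ?thesis
      by (simp add: sum_negf)
  qed
  have "(\<Sum>p\<in>I. ?c p * exp (\<mu> * ?e p)) = 0" if "exp_mean S \<mu> = exp_mean T \<mu>" for \<mu>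
  proof -
    have "(\<Sum>p\<in>S \<times> T. ?c p * exp (\<mu> * ?e p)) =
        (\<Sum>x\<in>S. x * exp (\<mu> * x)) * (\<Sum>y\<in>T. exp (\<mu> * y)) -
        (\<Sum>x\<in>S. exp (\<mu> * x)) * (\<Sum>y\<in>T. y * exp (\<mu> * y))"
      unfolding sum_product sum.cartesian_product sum_subtractf[symmetric]
      by (intro sum.cong) (auto simp: algebra_simps exp_add)
    also have "\<dots> = 0"
      using that sum_exp_pos[OF fin(1) ne(1), of \<mu>] sum_exp_pos[OF fin(2) ne(2), of \<mu>]
      by (simp add: exp_mean_def frac_eq_eq mult.commute)
    finally have "(\<Sum>p\<in>S \<times> T. ?c p * exp (\<mu> * ?e p)) = 0" .
    moreover have "(\<Sum>p\<in>I. ?c p * exp (\<mu> * ?e p)) =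
        (\<Sum>p\<in>S \<times> T. ?c p * exp (\<mu> * ?e p)) - (\<Sum>p\<in>U \<times> U. ?c p * exp (\<mu> * ?e p))"
      unfolding I_def using fin sub by (intro sum_diff) auto
    ultimately show ?thesis
      using cancel by simp
  qed
  then show ?thesis
    using nonzero by (auto elim!: eventually_mono)
qed

lemma eventually_exp_mean_neq:
  assumes fin: "finite S" "finite T" and ne: "S \<noteq> {}" "T \<noteq> {}" "S \<noteq> T"
  shows "\<forall>\<^sub>F \<mu> in at_top. exp_mean S \<mu> \<noteq> exp_mean T \<mu>"
proof -
  define \<gamma> where "\<gamma> = Max ((S - T) \<union> (T - S))"
  have D: "finite ((S - T) \<union> (T - S))" "(S - T) \<union> (T - S) \<noteq> {}"
    using fin ne by auto
  then have \<gamma>: "\<gamma> \<in> (S - T) \<union> (T - S)"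
    unfolding \<gamma>_def by (rule Max_in)
  have above: "x \<in> S \<longleftrightarrow> x \<in> T" if "x > \<gamma>" for x
    using that Max_ge[OF D(1), of x] by (auto simp: \<gamma>_def)
  show ?thesis
  proof (cases "\<gamma> \<in> S")
    case True
    then show ?thesis
      using \<gamma> above fin ne by (intro eventually_exp_mean_neq_aux) auto
  next
    case False
    then have "\<forall>\<^sub>F \<mu> in at_top. exp_mean T \<mu> \<noteq> exp_mean S \<mu>"
      using \<gamma> above fin ne by (intro eventually_exp_mean_neq_aux[where \<gamma> = \<gamma>]) auto
    then show ?thesis
      by (simp add: eq_commute)
  qed
qed

text \<open>For negative \<open>\<beta>\<close> the rate tends to minus infinity. Moving
  \<open>\<beta>\<close> into the sets reverses their order instead, so the limit at plus infinity
  covers both signs.\<close>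

lemma eventually_exp_mean_scaled_neq:
  assumes "finite S" "finite T" "S \<noteq> {}" "T \<noteq> {}" "S \<noteq> T" "\<beta> \<noteq> 0"
  shows "\<forall>\<^sub>F \<mu> in at_top. exp_mean S (\<mu> * \<beta>) \<noteq> exp_mean T (\<mu> * \<beta>)"
proof -
  have "inj ((*) \<beta>)"
    using assms by (auto intro: inj_onI)
  then have "(*) \<beta> ` S \<noteq> (*) \<beta> ` T"
    using assms by (simp add: inj_image_eq_iff)
  then have "\<forall>\<^sub>F \<mu> in at_top. exp_mean ((*) \<beta> ` S) \<mu> \<noteq> exp_mean ((*) \<beta> ` T) \<mu>"
    using assms by (intro eventually_exp_mean_neq) auto
  then show ?thesis
    using assms by (simp add: exp_mean_scale)
qed

section \<open>Interpolation by ReLU neurons\<close>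

text \<open>Placing one breakpoint below each node, but above the preceding one, makes the
  interpolation system triangular.\<close>
lemma relu_interpolation:
  fixes g :: "real \<Rightarrow> 'r \<Rightarrow> real"
  assumes "finite P"
  shows "\<exists>b c. \<forall>t\<in>P. \<forall>r. (\<Sum>j<card P. c r j * max 0 (t + b j)) = g t r"
  using assms
proof (induction P rule: finite_linorder_max_induct)
  case empty
  then show ?case by simp
next
  case (insert t P)
  then obtain b c where bc: "\<And>u r. u \<in> P \<Longrightarrow> (\<Sum>j<card P. c r j * max 0 (u + b j)) = g u r"
    by blast
  \<comment> \<open>The breakpoint of the new neuron; with no earlier node, any number below
    \<open>t\<close> would do.\<close>
  define \<tau> where "\<tau> = (if P = {} then t - 1 else Max P)"
  have \<tau>: "\<tau> < t" "\<And>u. u \<in> P \<Longrightarrow> u \<le> \<tau>"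
    using insert by (auto simp: \<tau>_def)
  define rest where "rest r = g t r - (\<Sum>j<card P. c r j * max 0 (t + b j))" for r
  \<comment> \<open>The new neuron vanishes at all earlier nodes and equals
    \<open>t - \<tau>\<close> at \<open>t\<close>, so its coefficient corrects the residual there
    without disturbing the rest. The breakpoints do not depend on \<open>r\<close>: all outputs
    share one hidden layer.\<close>
  define b' where "b' = b(card P := - \<tau>)"
  define c' where "c' r = (c r)(card P := rest r / (t - \<tau>))" for r
  have card: "card (insert t P) = Suc (card P)"
    using insert by auto
  have "(\<Sum>j<card P. c' r j * max 0 (u + b' j)) = (\<Sum>j<card P. c r j * max 0 (u + b j))" for u r
    by (intro sum.cong) (auto simp: b'_def c'_def)
  then have split: "(\<Sum>j<card (insert t P). c' r j * max 0 (u + b' j)) =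
      (\<Sum>j<card P. c r j * max 0 (u + b j)) + rest r / (t - \<tau>) * max 0 (u - \<tau>)" for u r
    unfolding card by (simp add: b'_def c'_def)
  have "(\<Sum>j<card (insert t P). c' r j * max 0 (u + b' j)) = g u r" if "u \<in> insert t P" for u r
  proof (cases "u = t")
    case True
    then show ?thesis
      using \<tau>(1) by (simp only: split) (simp add: rest_def)
  next
    case False
    then show ?thesis
      using that \<tau>(2)[of u] bc[of u r] by (simp only: split) simp
  qed
  then show ?case by blast
qed

text \<open>The architecture fixes the width in advance, but nodes may coincide when a token and its
  vocabulary recur; surplus neurons get coefficient 0.\<close>

lemma relu_interpolation_le:
  fixes g :: "real \<Rightarrow> 'r \<Rightarrow> real"
  assumes "finite P" "card P \<le> m"
  shows "\<exists>b c. \<forall>t\<in>P. \<forall>r. (\<Sum>j<m. c r j * max 0 (t + b j)) = g t r"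
proof -
  obtain b c where bc: "\<And>t r. t \<in> P \<Longrightarrow> (\<Sum>j<card P. c r j * max 0 (t + b j)) = g t r"
    using relu_interpolation[OF assms(1), of g] by auto
  let ?c = "\<lambda>r j. if j < card P then c r j else 0"
  have "(\<Sum>j<m. ?c r j * max 0 (t + b j)) = (\<Sum>j<card P. c r j * max 0 (t + b j))" for t r
    using assms(2) by (intro sum.mono_neutral_cong_right) auto
  then have "\<forall>t\<in>P. \<forall>r. (\<Sum>j<m. ?c r j * max 0 (t + b j)) = g t r"
    using bc by simp
  then show ?thesis
    by (intro exI[of _ b] exI[of _ ?c])
qed

section \<open>The separating transformer\<close>

lemma dim_outer_product [simp]:
  "dim_row (outer_product u v) = dim_vec u" "dim_col (outer_product u v) = dim_vec v"
  by (simp_all add: outer_product_def)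

lemma outer_product_carrier:
  "dim_vec u = nr \<Longrightarrow> dim_vec v = nc \<Longrightarrow> outer_product u v \<in> carrier_mat nr nc"
  by (intro carrier_matI) auto

lemma index_outer_product [simp]:
  "i < dim_vec u \<Longrightarrow> j < dim_vec v \<Longrightarrow> outer_product u v $$ (i, j) = u $ i * v $ j"
  by (simp add: outer_product_def)

lemma row_outer_product [simp]: "i < dim_vec u \<Longrightarrow> row (outer_product u v) i = u $ i \<cdot>\<^sub>v v"
  by (intro eq_vecI) auto

lemma col_outer_product [simp]: "j < dim_vec v \<Longrightarrow> col (outer_product u v) j = v $ j \<cdot>\<^sub>v u"
  by (intro eq_vecI) auto

lemma transpose_outer_product: "transpose_mat (outer_product u v) = outer_product v u"
  by (intro eq_matI) auto

lemma outer_product_mult: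
  "dim_row Z = dim_vec v \<Longrightarrow>
    outer_product u v * Z = outer_product u (vec (dim_col Z) (\<lambda>l. v \<bullet> col Z l))"
  by (intro eq_matI) auto

lemma outer_product_mult_outer_product:
  "dim_vec u' = dim_vec v \<Longrightarrow>
    outer_product u v * outer_product u' v' = outer_product ((v \<bullet> u') \<cdot>\<^sub>v u) v'"
  by (intro eq_matI) (auto simp: mult.commute)

lemma dim_softmax_mat [simp]:
  "dim_row (softmax_mat A) = dim_row A" "dim_col (softmax_mat A) = dim_col A"
  by (simp_all add: softmax_mat_def)

lemma index_softmax_mat [simp]:
  "l < dim_row A \<Longrightarrow> k < dim_col A \<Longrightarrow>
    softmax_mat A $$ (l, k) = exp (A $$ (l, k)) / (\<Sum>j<dim_row A. exp (A $$ (j, k)))"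
  by (simp add: softmax_mat_def mat_of_cols_index softmax_def)

text \<open>All attention matrices project onto the same direction \<open>a\<close>, and every ReLU neuron reads
  that projection too; the attention output moves tokens along the first basis vector only.\<close>
definition separating_weights ::
  "nat \<Rightarrow> nat \<Rightarrow> nat \<Rightarrow> real vec \<Rightarrow> real \<Rightarrow> real \<Rightarrow> (nat \<Rightarrow> real) \<Rightarrow> (nat \<Rightarrow> nat \<Rightarrow> real) \<Rightarrow>
    transformer_weights" where
  "separating_weights d s m a \<mu> \<delta> b c =
    \<lparr>WO = outer_product (\<delta> \<cdot>\<^sub>v unit_vec d 0) (unit_vec s 0),
     WV = outer_product (unit_vec s 0) a,
     WK = outer_product (\<mu> \<cdot>\<^sub>v unit_vec s 0) a,
     WQ = outer_product (unit_vec s 0) a,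
     W1 = mat m d (\<lambda>(j, r). a $ r),
     b1 = vec m b,
     W2 = mat d m (\<lambda>(r, j). c r j),
     b2 = 0\<^sub>v d\<rparr>"

text \<open>With \<open>\<alpha>\<close> the vector of projections, the scores are
  \<open>\<mu>\<close> times the outer product of \<open>\<alpha>\<close> with itself, so token
  \<open>k\<close> weights token \<open>l\<close> in proportion to
  \<open>exp (\<mu> * \<alpha> $ k * \<alpha> $ l)\<close>, and the values averaged are the entries
  of \<open>\<alpha>\<close>. Injectivity turns the sum over positions into one over the projected
  vocabulary.\<close>

lemma self_attention_separating:
  fixes d s m :: nat and a :: "real vec" and \<mu> \<delta> :: real
    and b :: "nat \<Rightarrow> real" and c :: "nat \<Rightarrow> nat \<Rightarrow> real"
  defines "w \<equiv> separating_weights d s m a \<mu> \<delta> b c"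
  assumes s: "s \<ge> 1" and a: "a \<in> carrier_vec d" and Z: "Z \<in> carrier_mat d n"
    and inj: "inj_on (\<lambda>l. a \<bullet> col Z l) {..<n}"
  shows "self_attention w Z \<in> carrier_mat d n"
    and "k < n \<Longrightarrow> col (self_attention w Z) k = col Z k +
      (\<delta> * exp_mean ((\<bullet>) a ` vocabulary Z) (\<mu> * (a \<bullet> col Z k))) \<cdot>\<^sub>v unit_vec d 0"
proof -
  define \<alpha> where "\<alpha> = vec n (\<lambda>l. a \<bullet> col Z l)"
  have dims: "dim_vec a = d" "dim_row Z = d" "dim_col Z = n" "dim_vec \<alpha> = n"
    using a Z by (auto simp: \<alpha>_def)
  have e0: "unit_vec s 0 \<bullet> unit_vec s 0 = (1::real)"
    using s by simp
  have proj: "outer_product u a * Z = outer_product u \<alpha>" for u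
    using dims by (simp add: outer_product_mult \<alpha>_def)
  have scores: "transpose_mat (WK w * Z) * (WQ w * Z) = outer_product (\<mu> \<cdot>\<^sub>v \<alpha>) \<alpha>"
    using s by (simp add: w_def separating_weights_def proj transpose_outer_product
        outer_product_mult_outer_product)
  have "WO w * (WV w * Z) = outer_product (\<delta> \<cdot>\<^sub>v unit_vec d 0) \<alpha>"
    using s by (simp add: w_def separating_weights_def proj outer_product_mult_outer_product)
  then have attn: "self_attention w Z =
      Z + outer_product (\<delta> \<cdot>\<^sub>v unit_vec d 0) \<alpha> * softmax_mat (outer_product (\<mu> \<cdot>\<^sub>v \<alpha>) \<alpha>)"
    by (simp add: self_attention_def scores)
  then show carrier: "self_attention w Z \<in> carrier_mat d n"
    by (intro carrier_matI) (simp_all add: dims)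
  assume k: "k < n"
  have vocab: "(\<bullet>) a ` vocabulary Z = (\<lambda>l. a \<bullet> col Z l) ` {..<n}"
    using dims by (auto simp: vocabulary_def)
  have mean: "\<alpha> \<bullet> col (softmax_mat (outer_product (\<mu> \<cdot>\<^sub>v \<alpha>) \<alpha>)) k =
      exp_mean ((\<bullet>) a ` vocabulary Z) (\<mu> * (a \<bullet> col Z k))"
  proof -
    let ?P = "softmax_mat (outer_product (\<mu> \<cdot>\<^sub>v \<alpha>) \<alpha>)"
    have "\<alpha> \<bullet> col ?P k = (\<Sum>l<n. \<alpha> $ l * ?P $$ (l, k))"
      using k dims by (simp add: scalar_prod_def[of \<alpha>] atLeast0LessThan)
    also have "\<dots> = (\<Sum>l<n. \<alpha> $ l * exp (\<mu> * \<alpha> $ k * \<alpha> $ l)) / (\<Sum>l<n. exp (\<mu> * \<alpha> $ k * \<alpha> $ l))"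
      using k dims by (simp add: sum_divide_distrib mult_ac)
    also have "\<dots> = exp_mean ((\<bullet>) a ` vocabulary Z) (\<mu> * (a \<bullet> col Z k))"
      using k unfolding vocab exp_mean_def sum.reindex[OF inj] by (simp add: \<alpha>_def)
    finally show ?thesis .
  qed
  show "col (self_attention w Z) k = col Z k +
      (\<delta> * exp_mean ((\<bullet>) a ` vocabulary Z) (\<mu> * (a \<bullet> col Z k))) \<cdot>\<^sub>v unit_vec d 0"
    using k by (intro eq_vecI) (auto simp: attn dims mean[symmetric])
qed

lemma feed_forward_token_separating:
  assumes "a \<in> carrier_vec d" "h \<in> carrier_vec d" "r < d"
  shows "feed_forward_token (separating_weights d s m a \<mu> \<delta> b c) h $ r =
    h $ r + (\<Sum>j<m. c r j * max 0 (a \<bullet> h + b j))"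
proof -
  have "row (mat m d (\<lambda>(j, r). a $ r)) j = a" if "j < m" for j
    using assms that by (intro eq_vecI) auto
  then have neuron: "relu_vec (mat m d (\<lambda>(j, r). a $ r) *\<^sub>v h + vec m b) $ j = max 0 (a \<bullet> h + b j)"
    if "j < m" for j
    using that by (simp add: relu_vec_def)
  let ?v = "relu_vec (mat m d (\<lambda>(j, r). a $ r) *\<^sub>v h + vec m b)"
  have "dim_vec ?v = m"
    by (simp add: relu_vec_def)
  then have "(mat d m (\<lambda>(r, j). c r j) *\<^sub>v ?v) $ r = (\<Sum>j<m. c r j * ?v $ j)"
    using assms by (simp add: scalar_prod_def atLeast0LessThan)
  also have "\<dots> = (\<Sum>j<m. c r j * max 0 (a \<bullet> h + b j))"
    by (intro sum.cong refl) (simp add: neuron)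
  finally show ?thesis
    using assms by (simp add: feed_forward_token_def separating_weights_def)
qed

lemma transformer_separating:
  fixes d s m :: nat and a :: "real vec" and \<mu> \<delta> :: real
    and b :: "nat \<Rightarrow> real" and c :: "nat \<Rightarrow> nat \<Rightarrow> real"
  defines "w \<equiv> separating_weights d s m a \<mu> \<delta> b c"
  assumes s: "s \<ge> 1" and a: "a \<in> carrier_vec d" and Z: "Z \<in> carrier_mat d n"
    and inj: "inj_on (\<lambda>l. a \<bullet> col Z l) {..<n}"
    and h: "\<And>k. h k = col Z k +
      (\<delta> * exp_mean ((\<bullet>) a ` vocabulary Z) (\<mu> * (a \<bullet> col Z k))) \<cdot>\<^sub>v unit_vec d 0"
  shows "transformer w Z \<in> carrier_mat d n"
    and "r < d \<Longrightarrow> k < n \<Longrightarrow>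
      transformer w Z $$ (r, k) = h k $ r + (\<Sum>j<m. c r j * max 0 (a \<bullet> h k + b j))"
proof -
  note sa = self_attention_separating[OF s a Z inj, where \<mu> = \<mu> and \<delta> = \<delta> and m = m and b = b and c = c, folded w_def]
  show "transformer w Z \<in> carrier_mat d n"
    using sa(1) by (intro carrier_matI) (auto simp: transformer_def feed_forward_def)
  assume rk: "r < d" "k < n"
  have "transformer w Z $$ (r, k) = feed_forward_token w (col (self_attention w Z) k) $ r"
    using rk sa(1) by (simp add: transformer_def feed_forward_def mat_of_cols_index)
  also have "col (self_attention w Z) k = h k"
    using rk by (simp add: sa(2) h)
  also have "feed_forward_token w (h k) $ r = h k $ r + (\<Sum>j<m. c r j * max 0 (a \<bullet> h k + b j))"
    unfolding w_def using rk a Z by (intro feed_forward_token_separating) (auto simp: h)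
  finally show "transformer w Z $$ (r, k) = h k $ r + (\<Sum>j<m. c r j * max 0 (a \<bullet> h k + b j))" .
qed

section \<open>Free scalars of the architecture\<close>

lemma has_form_outer_product: "has_form Outer_Product (outer_product u v)"
  unfolding has_form.simps by blast

text \<open>Labels in \<open>labels_W1\<close> ignore the row \<open>j\<close>, so all neurons share
  the \<open>d\<close> entries of \<open>a\<close>. The next \<open>m\<close> labels are the biases,
  and the last \<open>d * m\<close> number the output weights row by row.\<close>

definition separating_architecture :: "nat \<Rightarrow> nat \<Rightarrow> architecture" where
  "separating_architecture d m =
    \<lparr>form_O = Outer_Product, form_V = Outer_Product, form_K = Outer_Product,
     form_Q = Outer_Product,
     labels_W1 = mat m d (\<lambda>(j, r). Some r),
     labels_b1 = vec m (\<lambda>j. Some (d + j)),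
     labels_W2 = mat d m (\<lambda>(r, j). Some (d + m + (r * m + j))),
     labels_b2 = vec d (\<lambda>_. None)\<rparr>"

lemma feed_forward_shape_separating: "m \<ge> 1 \<Longrightarrow> feed_forward_shape d (separating_architecture d m)"
  by (auto simp: feed_forward_shape_def separating_architecture_def)

lemma mult_add_less_mult:
  fixes r j d m :: nat
  assumes "r < d" "j < m"
  shows "r * m + j < d * m"
proof -
  have "r * m + j < Suc r * m"
    using assms by simp
  also have "\<dots> \<le> d * m"
    using assms by (intro mult_le_mono1) simp
  finally show ?thesis .
qed

lemma parameter_count_separating:
  "parameter_count d s (separating_architecture d m) \<le> 4 * (s + d) + (d + m + d * m)"
proof -
  have "feed_forward_scalars (separating_architecture d m) \<subseteq> {..<d + m + d * m}"
    by (auto simp: feed_forward_scalars_def separating_architecture_def vec_set_def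
        dest!: elements_matD intro: mult_add_less_mult)
  then have "card (feed_forward_scalars (separating_architecture d m)) \<le> card {..<d + m + d * m}"
    by (intro card_mono) auto
  then show ?thesis
    by (simp add: parameter_count_def separating_architecture_def)
qed

lemma weights_of_separating_architecture:
  assumes a: "a \<in> carrier_vec d"
  shows "weights_of_architecture d s (separating_architecture d m)
    (separating_weights d s m a \<mu> \<delta> b c)"
proof -
  \<comment> \<open>Inverts the numbering of the labels; \<open>div\<close> and \<open>mod\<close>
    recover row and column of an output weight.\<close>
  define \<theta> where "\<theta> p = (if p < d then a $ p else if p < d + m then b (p - d)
    else c ((p - d - m) div m) ((p - d - m) mod m))" for p
  let ?A = "separating_architecture d m" and ?w = "separating_weights d s m a \<mu> \<delta> b c"
  have decode: "\<theta> (d + m + (r * m + j)) = c r j" if "j < m" for r j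
    using that by (simp add: \<theta>_def)
  have "W1 ?w = map_mat (label_value \<theta>) (labels_W1 ?A)"
    "b1 ?w = map_vec (label_value \<theta>) (labels_b1 ?A)"
    "W2 ?w = map_mat (label_value \<theta>) (labels_W2 ?A)"
    "b2 ?w = map_vec (label_value \<theta>) (labels_b2 ?A)"
    unfolding separating_weights_def separating_architecture_def
    by (auto simp: decode) (auto simp: \<theta>_def)
  then have ff: "\<exists>\<theta>. W1 ?w = map_mat (label_value \<theta>) (labels_W1 ?A) \<and>
      b1 ?w = map_vec (label_value \<theta>) (labels_b1 ?A) \<and>
      W2 ?w = map_mat (label_value \<theta>) (labels_W2 ?A) \<and>
      b2 ?w = map_vec (label_value \<theta>) (labels_b2 ?A)"
    by blast
  have "WO ?w \<in> carrier_mat d s \<and> has_form (form_O ?A) (WO ?w) \<and>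
      WV ?w \<in> carrier_mat s d \<and> has_form (form_V ?A) (WV ?w) \<and>
      WK ?w \<in> carrier_mat s d \<and> has_form (form_K ?A) (WK ?w) \<and>
      WQ ?w \<in> carrier_mat s d \<and> has_form (form_Q ?A) (WQ ?w)"
    using a by (simp add: separating_weights_def separating_architecture_def
        has_form_outer_product outer_product_carrier del: has_form.simps)
  with ff show ?thesis
    unfolding weights_of_architecture_def by simp
qed

section \<open>Choice of generic parameters and exact memorization\<close>

lemma l2_norm_zero [simp]: "l2_norm (0\<^sub>v d) = 0"
  by (simp add: l2_norm_def L2_set_def)

theorem corollary1:
  fixes d n N s :: nat
  assumes "d \<ge> 1" and "n \<ge> 1" and "N \<ge> 1" and "s \<ge> 1"
  shows "\<exists>A. feed_forward_shape d A \<and>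
    parameter_count d s A \<le> 4 * (s + d) + d * (2 * n * N + d) \<and>
    (\<forall>(C::nat) (\<epsilon>::real) (rmin::real) (rmax::real) (X::nat \<Rightarrow> real mat) (Y::nat \<Rightarrow> nat mat).
       C \<ge> 1 \<longrightarrow> \<epsilon> > 0 \<longrightarrow> rmax > rmin \<longrightarrow> rmin > 0 \<longrightarrow>
       (\<forall>i<N. X i \<in> carrier_mat d n) \<longrightarrow>
       (\<forall>i<N. Y i \<in> carrier_mat d n \<and> (\<forall>r<d. \<forall>k<n. Y i $$ (r, k) \<in> {1..C})) \<longrightarrow>
       tokenwise_separated N n rmin rmax \<epsilon> X \<longrightarrow>
       no_duplicate_tokens N n X \<longrightarrow>
       consistently_labeled N n X Y \<longrightarrow>
       (\<exists>w. weights_of_architecture d s A w \<and>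
            (\<forall>i<N. transformer w (X i) = map_mat real (Y i))))"
proof (intro exI[of _ "separating_architecture d (n * N)"] conjI allI impI)
  let ?m = "n * N"
  show "feed_forward_shape d (separating_architecture d ?m)"
    using assms by (intro feed_forward_shape_separating) simp
  \<comment> \<open>The shared input direction is paid for by \<open>d * d\<close>, and the biases
    by the second copy of \<open>d * ?m\<close>.\<close>
  have "?m \<le> d * ?m" "d \<le> d * d"
    using \<open>d \<ge> 1\<close> by auto
  then have "d + ?m + d * ?m \<le> d * d + d * ?m + d * ?m"
    by linarith
  also have "\<dots> = d * (2 * n * N + d)"
    by (simp add: algebra_simps)
  finally have "d + ?m + d * ?m \<le> d * (2 * n * N + d)" .
  then show "parameter_count d s (separating_architecture d ?m) \<le>
      4 * (s + d) + d * (2 * n * N + d)"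
    using parameter_count_separating[of d s ?m] by linarith

  fix C :: nat and \<epsilon> rmin rmax :: real and X :: "nat \<Rightarrow> real mat" and Y :: "nat \<Rightarrow> nat mat"
  assume rmin: "rmin > 0"
    and X: "\<forall>i<N. X i \<in> carrier_mat d n"
    and Y: "\<forall>i<N. Y i \<in> carrier_mat d n \<and> (\<forall>r<d. \<forall>k<n. Y i $$ (r, k) \<in> {1..C})"
    and sep: "tokenwise_separated N n rmin rmax \<epsilon> X"
    and nodup: "no_duplicate_tokens N n X"
    and label: "consistently_labeled N n X Y"

  define x where "x = (\<lambda>(i, k). col (X i) k)"
  define I where "I = {..<N} \<times> {..<n}"
  have I [simp]: "finite I" "card I = ?m"
    by (simp_all add: I_def)
  have x_carrier: "x p \<in> carrier_vec d" if "p \<in> I" for p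
    using that X col_dim by (fastforce simp: x_def I_def)
  \<comment> \<open>The positive lower bound on the norms excludes the zero token.\<close>
  have x_nz: "x p \<noteq> 0\<^sub>v d" if "p \<in> I" for p
    using that sep rmin unfolding tokenwise_separated_def x_def I_def by fastforce
  have vocab: "vocabulary (X i) = (\<lambda>k. x (i, k)) ` {..<n}" if "i < N" for i
    using that X by (auto simp: vocabulary_def x_def)

  \<comment> \<open>The basis vector makes the attention shift visible to \<open>a\<close>, the
    tokens give nonzero rates, and the differences keep distinct tokens apart.\<close>
  define V where "V = insert (unit_vec d 0) (x ` I \<union> (\<lambda>(p, q). x p - x q) ` (I \<times> I)) - {0\<^sub>v d}"
  have "finite V" "V \<subseteq> carrier_vec d" "0\<^sub>v d \<notin> V"
    using x_carrier by (auto simp: V_def)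
  then obtain a where a: "a \<in> carrier_vec d" and a_V: "\<And>v. v \<in> V \<Longrightarrow> a \<bullet> v \<noteq> 0"
    using exists_generic_vec[of V d] by blast
  define \<alpha> where "\<alpha> p = a \<bullet> x p" for p
  have \<alpha>_nz: "\<alpha> p \<noteq> 0" if "p \<in> I" for p
    using that x_nz a_V by (auto simp: \<alpha>_def V_def)
  have \<alpha>_inj: "x p = x q" if "p \<in> I" "q \<in> I" "\<alpha> p = \<alpha> q" for p q
  proof (rule ccontr)
    assume "x p \<noteq> x q"
    have "x p - x q \<noteq> 0\<^sub>v d"
    proof
      assume "x p - x q = 0\<^sub>v d"
      then have "x p $ r = x q $ r" if "r < d" for r
        using that x_carrier[OF \<open>p \<in> I\<close>] x_carrier[OF \<open>q \<in> I\<close>]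
        by (metis carrier_vecD eq_iff_diff_eq_0 index_minus_vec(1) index_zero_vec(1))
      then show False
        using \<open>x p \<noteq> x q\<close> x_carrier[OF \<open>p \<in> I\<close>] x_carrier[OF \<open>q \<in> I\<close>] by auto
    qed
    then have "x p - x q \<in> V"
      using that by (auto simp: V_def)
    then have "a \<bullet> (x p - x q) \<noteq> 0"
      by (rule a_V)
    then show False
      using that a x_carrier by (simp add: \<alpha>_def scalar_prod_minus_distrib)
  qed
  have a0: "a $ 0 \<noteq> 0"
  proof -
    have "unit_vec d 0 \<noteq> (0\<^sub>v d :: real vec)"
      using \<open>d \<ge> 1\<close> by (metis index_unit_vec(2) index_zero_vec(1) less_eq_Suc_le One_nat_def zero_neq_one)
    then have "a \<bullet> unit_vec d 0 \<noteq> 0"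
      using a_V by (auto simp: V_def)
    then show ?thesis
      using a \<open>d \<ge> 1\<close> by simp
  qed

  define S where "S i = (\<bullet>) a ` vocabulary (X i)" for i
  have S: "S i = (\<lambda>k. \<alpha> (i, k)) ` {..<n}" if "i < N" for i
    using that by (simp add: S_def vocab image_image \<alpha>_def)
  have S_inj: "vocabulary (X i) = vocabulary (X j)" if "i < N" "j < N" "S i = S j" for i j
  proof -
    have "inj_on ((\<bullet>) a) (x ` I)"
      using \<alpha>_inj by (auto simp: inj_on_def \<alpha>_def)
    moreover have "vocabulary (X i) \<subseteq> x ` I" "vocabulary (X j) \<subseteq> x ` I"
      using that vocab by (auto simp: I_def)
    ultimately show ?thesis
      using that(3) unfolding S_def by (simp add: inj_on_image_eq_iff)
  qed

  \<comment> \<open>Means need to differ only for equal tokens in different vocabularies, so both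
    sides have the same rate. Each of the finitely many conditions holds eventually, hence one
    \<open>\<mu>\<close> meets them all.\<close>
  have "\<forall>\<^sub>F \<mu> in at_top. \<forall>(p, j)\<in>I \<times> {..<N}. S (fst p) \<noteq> S j \<longrightarrow>
      exp_mean (S (fst p)) (\<mu> * \<alpha> p) \<noteq> exp_mean (S j) (\<mu> * \<alpha> p)"
  proof (intro eventually_ball_finite ballI)
    fix pj assume "pj \<in> I \<times> {..<N}"
    then obtain p j where pj: "pj = (p, j)" "p \<in> I" "j < N" "fst p < N"
      by (auto simp: I_def)
    have fin: "finite (S i)" "S i \<noteq> {}" if "i < N" for i
      using that \<open>n \<ge> 1\<close> by (auto simp: S lessThan_empty_iff)
    show "\<forall>\<^sub>F \<mu> in at_top. case pj of (p, j) \<Rightarrow> S (fst p) \<noteq> S j \<longrightarrow>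
        exp_mean (S (fst p)) (\<mu> * \<alpha> p) \<noteq> exp_mean (S j) (\<mu> * \<alpha> p)"
      using eventually_exp_mean_scaled_neq[of "S (fst p)" "S j" "\<alpha> p"] pj fin \<alpha>_nz
      by (cases "S (fst p) = S j") auto
  qed auto
  then obtain \<mu> where \<mu>: "\<And>p j. p \<in> I \<Longrightarrow> j < N \<Longrightarrow> S (fst p) \<noteq> S j \<Longrightarrow>
      exp_mean (S (fst p)) (\<mu> * \<alpha> p) \<noteq> exp_mean (S j) (\<mu> * \<alpha> p)"
    using eventually_happens'[OF trivial_limit_at_top_linorder] by fastforce

  define G where "G p = exp_mean (S (fst p)) (\<mu> * \<alpha> p)" for p
  \<comment> \<open>A shift by \<open>\<delta> * G p\<close> along the first basis vector changes
    the projection by that amount times \<open>a $ 0\<close>, hence this factor in the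
    pairs.\<close>
  obtain \<delta> where \<delta>: "inj_on (\<lambda>(p, q). p + \<delta> * q) ((\<lambda>p. (\<alpha> p, a $ 0 * G p)) ` I)"
    using exists_inj_on_linear_comb[of "(\<lambda>p. (\<alpha> p, a $ 0 * G p)) ` I"] by auto
  define h where "h p = x p + (\<delta> * G p) \<cdot>\<^sub>v unit_vec d 0" for p
  define t where "t p = a \<bullet> h p" for p
  have t: "t p = \<alpha> p + \<delta> * (a $ 0 * G p)" if "p \<in> I" for p
    using that a x_carrier \<open>d \<ge> 1\<close>
    by (simp add: t_def h_def \<alpha>_def scalar_prod_add_distrib[of _ d])
  define y where "y = (\<lambda>(i, k) r. real (Y i $$ (r, k)) - h (i, k) $ r)"
  \<comment> \<open>Equal \<open>t\<close> forces equal \<open>\<alpha>\<close> and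
    \<open>G\<close>. The former gives equal tokens; both together give equal vocabularies, by the
    choice of \<open>\<mu>\<close>. Consistent labeling then makes \<open>y\<close> a function of
    \<open>t\<close>.\<close>
  have separated: "y p r = y q r" if p: "p \<in> I" and q: "q \<in> I" and eq: "t p = t q" and r: "r < d" for p q r
  proof -
    have "(\<alpha> p, a $ 0 * G p) = (\<alpha> q, a $ 0 * G q)"
      using eq p q by (intro inj_onD[OF \<delta>]) (auto simp: t)
    then have \<alpha>: "\<alpha> p = \<alpha> q" and G: "G p = G q"
      using a0 by auto
    obtain i k j l where pq: "p = (i, k)" "q = (j, l)" "i < N" "k < n" "j < N" "l < n"
      using p q by (auto simp: I_def)
    have "S i = S j"
      using \<mu>[OF p, of j] \<alpha> G pq by (auto simp: G_def)
    then have "vocabulary (X i) = vocabulary (X j)"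
      using S_inj[OF pq(3,5)] by blast
    moreover have xpq: "x p = x q"
      using \<alpha>_inj p q \<alpha> by blast
    moreover have "col (X i) k = col (X j) l"
      using xpq by (simp add: x_def pq(1,2))
    ultimately have "col (Y i) k = col (Y j) l"
      using label pq(3-6) unfolding consistently_labeled_def by blast
    then have "col (Y i) k $ r = col (Y j) l $ r"
      by simp
    moreover have "Y i \<in> carrier_mat d n" "Y j \<in> carrier_mat d n"
      using Y pq by auto
    ultimately have "Y i $$ (r, k) = Y j $$ (r, l)"
      using pq(3-6) r by simp
    then show ?thesis
      using xpq G pq by (simp add: y_def h_def)
  qed
  have "card (t ` I) \<le> ?m"
    using card_image_le[OF I(1), of t] by simp
  \<comment> \<open>\<open>inv_into\<close> picks some token for each node; by
    \<open>separated\<close> the choice does not affect the target.\<close>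
  then obtain b c where bc: "\<And>p r. p \<in> I \<Longrightarrow>
      (\<Sum>j<?m. c r j * max 0 (t p + b j)) = y (inv_into I t (t p)) r"
    using relu_interpolation_le[of "t ` I" ?m "\<lambda>u. y (inv_into I t u)"] by auto
  define w where "w = separating_weights d s ?m a \<mu> \<delta> b c"
  have "transformer w (X i) = map_mat real (Y i)" if i: "i < N" for i
  proof -
    have Xi: "X i \<in> carrier_mat d n" and Yi: "Y i \<in> carrier_mat d n"
      using X Y i by auto
    \<comment> \<open>The absence of duplicates within a sequence makes its softmax sums sums over
      the set \<open>S i\<close>.\<close>
    have "inj_on (\<lambda>l. a \<bullet> col (X i) l) {..<n}"
    proof (rule inj_onI)
      fix k l assume kl: "k \<in> {..<n}" "l \<in> {..<n}" "a \<bullet> col (X i) k = a \<bullet> col (X i) l"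
      then have "x (i, k) = x (i, l)"
        using i by (intro \<alpha>_inj) (auto simp: \<alpha>_def x_def I_def)
      then show "k = l"
        using nodup i kl by (auto simp: no_duplicate_tokens_def x_def)
    qed
    note tr = transformer_separating[OF \<open>s \<ge> 1\<close> a Xi this,
        where h = "\<lambda>k. h (i, k)" and \<mu> = \<mu> and \<delta> = \<delta> and m = ?m and b = b and c = c,
        folded w_def]
    have h: "h (i, k) = col (X i) k + (\<delta> * exp_mean ((\<bullet>) a ` vocabulary (X i))
        (\<mu> * (a \<bullet> col (X i) k))) \<cdot>\<^sub>v unit_vec d 0" for k
      by (simp add: h_def G_def S_def \<alpha>_def x_def)
    have "transformer w (X i) $$ (r, k) = real (Y i $$ (r, k))" if rk: "r < d" "k < n" for r k
    proof -
      have ik: "(i, k) \<in> I"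
        using i rk by (simp add: I_def)
      let ?q = "inv_into I t (t (i, k))"
      have "?q \<in> I" "t ?q = t (i, k)"
        using ik by (auto intro: inv_into_into f_inv_into_f)
      then have "y ?q r = y (i, k) r"
        using separated ik rk by blast
      then show ?thesis
        using tr(2)[OF h rk] bc[OF ik, of r] by (simp add: t_def y_def)
    qed
    then show ?thesis
      using tr(1)[OF h] Yi by (intro eq_matI) auto
  qed
  then show "\<exists>w. weights_of_architecture d s (separating_architecture d ?m) w \<and>
      (\<forall>i<N. transformer w (X i) = map_mat real (Y i))"
    using weights_of_separating_architecture[OF a] unfolding w_def by blast
qed

end
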